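(* Let $V$ be a finite set and let $\mathcal{L}\subseteq\mathcal{T}(V)$ be a semigraphoid. Then $\mathcal{L}$ is closed under the pseudographoid rule if and only if it is closed under intersection.
   Context: For a finite set $V$, $\mathcal{T}(V)$ is the set of all triples $(A,B|C)$ with $A,B,C\subseteq V$ pairwise disjoint and $A,B$ nonempty ($C$ may be empty). A relation is a subset of $\mathcal{T}(V)$. Juxtaposition denotes union ($BC=B\cup C$), and lowercase letters denote elements of $V$ identified with singletons. A relation $\mathcal{L}$ is a semigraphoid if for all pairwise disjoint $A,B,C,S\subseteq V$ with $A,B,C$ nonempty it is closed under: symmetry, $(A,B|S)\in\mathcal{L}\iff(B,A|S)\in\mathcal{L}$; decomposition, $(A,BC|S)\in\mathcal{L}\Rightarrow(A,B|S)\in\mathcal{L}$; weak union, $(A,BC|S)\in\mathcal{L}\Rightarrow(A,B|SC)\in\mathcal{L}$; contraction, $(A,B|S),(A,C|BS)\in\mathcal{L}\Rightarrow(A,BC|S)\in\mathcal{L}$. Closed under the pseudographoid rule: for all distinct $a,b,c\in V$ and $S\subseteq V\setminus\{a,b,c\}$, $(a,b|Sc),(a,c|Sb)\in\mathcal{L}$ implies $(a,b|S),(a,c|S)\in\mathcal{L}$. Closed under intersection: for all pairwise disjoint $A,B,C,S\subseteq V$ with $A,B,C$ nonempty, $(A,B|SC),(A,C|SB)\in\mathcal{L}$ implies $(A,BC|S)\in\mathcal{L}$. *)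

theory Defs
  imports Main
begin

text \<open>The triple \<open>(A, B, C)\<close> stands for \<open>(A,B|C)\<close>.\<close>

definition triples :: "'v set \<Rightarrow> ('v set \<times> 'v set \<times> 'v set) set" where
  "triples V = {(A, B, C). A \<subseteq> V \<and> B \<subseteq> V \<and> C \<subseteq> V \<and>
     A \<inter> B = {} \<and> A \<inter> C = {} \<and> B \<inter> C = {} \<and> A \<noteq> {} \<and> B \<noteq> {}}"

definition disjoint_quad :: "'v set \<Rightarrow> 'v set \<Rightarrow> 'v set \<Rightarrow> 'v set \<Rightarrow> 'v set \<Rightarrow> bool" where
  "disjoint_quad V A B C S \<longleftrightarrow>
     A \<subseteq> V \<and> B \<subseteq> V \<and> C \<subseteq> V \<and> S \<subseteq> V \<and>
     A \<inter> B = {} \<and> A \<inter> C = {} \<and> A \<inter> S = {} \<and> B \<inter> C = {} \<and> B \<inter> S = {} \<and> C \<inter> S = {} \<and>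
     A \<noteq> {} \<and> B \<noteq> {} \<and> C \<noteq> {}"

text \<open>Symmetry involves no third set, so it is imposed on all triples, including those with
  \<open>A \<union> B \<union> S = V\<close>, where no further nonempty disjoint set exists.\<close>

definition semigraphoid :: "'v set \<Rightarrow> ('v set \<times> 'v set \<times> 'v set) set \<Rightarrow> bool" where
  "semigraphoid V L \<longleftrightarrow>
     L \<subseteq> triples V \<and>
     (\<forall>A B S. (A, B, S) \<in> triples V \<longrightarrow> ((A, B, S) \<in> L \<longleftrightarrow> (B, A, S) \<in> L)) \<and>
     (\<forall>A B C S. disjoint_quad V A B C S \<longrightarrow> (A, B \<union> C, S) \<in> L \<longrightarrow> (A, B, S) \<in> L) \<and>
     (\<forall>A B C S. disjoint_quad V A B C S \<longrightarrow> (A, B \<union> C, S) \<in> L \<longrightarrow> (A, B, S \<union> C) \<in> L) \<and>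
     (\<forall>A B C S. disjoint_quad V A B C S \<longrightarrow>
        (A, B, S) \<in> L \<longrightarrow> (A, C, B \<union> S) \<in> L \<longrightarrow> (A, B \<union> C, S) \<in> L)"

definition pseudographoid_closed :: "'v set \<Rightarrow> ('v set \<times> 'v set \<times> 'v set) set \<Rightarrow> bool" where
  "pseudographoid_closed V L \<longleftrightarrow>
     (\<forall>a\<in>V. \<forall>b\<in>V. \<forall>c\<in>V. \<forall>S. a \<noteq> b \<longrightarrow> a \<noteq> c \<longrightarrow> b \<noteq> c \<longrightarrow> S \<subseteq> V - {a, b, c} \<longrightarrow>
        ({a}, {b}, S \<union> {c}) \<in> L \<longrightarrow> ({a}, {c}, S \<union> {b}) \<in> L \<longrightarrow>
        ({a}, {b}, S) \<in> L \<and> ({a}, {c}, S) \<in> L)"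

definition intersection_closed :: "'v set \<Rightarrow> ('v set \<times> 'v set \<times> 'v set) set \<Rightarrow> bool" where
  "intersection_closed V L \<longleftrightarrow>
     (\<forall>A B C S. disjoint_quad V A B C S \<longrightarrow>
        (A, B, S \<union> C) \<in> L \<longrightarrow> (A, C, S \<union> B) \<in> L \<longrightarrow> (A, B \<union> C, S) \<in> L)"

end

theory Submission
  imports Defs
begin

text \<open>
  For singletons, intersection and the pseudographoid rule have the same content: contraction leads
  from the latter to the former and decomposition leads back. Only the step from singletons to
  arbitrary sets needs an argument. Fix the three
  nonempty sets \<open>A\<close>, \<open>B\<close>, \<open>C\<close> and ask that intersection hold for them over every conditioning set
  \<open>S\<close>; call this property \<open>I(A,B,C)\<close>. The semigraphoid axioms make \<open>I\<close> additive in each of its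
  arguments: \<open>I(A,B,C\<^sub>1)\<close> and \<open>I(A,B,C\<^sub>2)\<close> give \<open>I(A,B,C\<^sub>1C\<^sub>2)\<close> for disjoint \<open>C\<^sub>1\<close>, \<open>C\<^sub>2\<close>, and
  likewise for \<open>A\<close>; the argument \<open>B\<close> is covered because the rule is symmetric in \<open>B\<close> and \<open>C\<close>.
  Quantifying over \<open>S\<close> is what makes this work, since one part of a split set moves into the
  conditioning set while the other part is treated. As \<open>V\<close> is finite, every set is built up from
  singletons by adding one element at a time, and the pseudographoid rule is the base case.
\<close>

lemma semigraphoid_symmetry:
  assumes "semigraphoid V L" "(A, B, S) \<in> L"
  shows "(B, A, S) \<in> L"
proof -
  have "L \<subseteq> triples V"
    using assms(1) unfolding semigraphoid_def by (elim conjE)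
  then have "(A, B, S) \<in> triples V"
    using assms(2) by (rule subsetD)
  moreover have "\<forall>A B S. (A, B, S) \<in> triples V \<longrightarrow> ((A, B, S) \<in> L \<longleftrightarrow> (B, A, S) \<in> L)"
    using assms(1) unfolding semigraphoid_def by (elim conjE)
  ultimately have "(A, B, S) \<in> L \<longleftrightarrow> (B, A, S) \<in> L"
    by metis
  then show ?thesis
    using assms(2) by (rule iffD1)
qed

lemma semigraphoid_decomposition:
  assumes "semigraphoid V L" "disjoint_quad V A B C S" "(A, B \<union> C, S) \<in> L"
  shows "(A, B, S) \<in> L"
proof -
  have "\<forall>A B C S. disjoint_quad V A B C S \<longrightarrow> (A, B \<union> C, S) \<in> L \<longrightarrow> (A, B, S) \<in> L"
    using assms(1) unfolding semigraphoid_def by (elim conjE)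
  then show ?thesis
    using assms(2,3) by simp
qed

lemma semigraphoid_weak_union:
  assumes "semigraphoid V L" "disjoint_quad V A B C S" "(A, B \<union> C, S) \<in> L"
  shows "(A, B, S \<union> C) \<in> L"
proof -
  have "\<forall>A B C S. disjoint_quad V A B C S \<longrightarrow> (A, B \<union> C, S) \<in> L \<longrightarrow> (A, B, S \<union> C) \<in> L"
    using assms(1) unfolding semigraphoid_def by (elim conjE)
  then show ?thesis
    using assms(2,3) by simp
qed

lemma semigraphoid_contraction:
  assumes "semigraphoid V L" "disjoint_quad V A B C S" "(A, B, S) \<in> L" "(A, C, B \<union> S) \<in> L"
  shows "(A, B \<union> C, S) \<in> L"
proof -
  have "\<forall>A B C S. disjoint_quad V A B C S \<longrightarrow>
      (A, B, S) \<in> L \<longrightarrow> (A, C, B \<union> S) \<in> L \<longrightarrow> (A, B \<union> C, S) \<in> L"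
    using assms(1) unfolding semigraphoid_def by (elim conjE)
  then show ?thesis
    using assms(2-4) by simp
qed

definition intersection_for ::
  "'v set \<Rightarrow> ('v set \<times> 'v set \<times> 'v set) set \<Rightarrow> 'v set \<Rightarrow> 'v set \<Rightarrow> 'v set \<Rightarrow> bool" where
  "intersection_for V L A B C \<longleftrightarrow>
     (\<forall>S. disjoint_quad V A B C S \<longrightarrow>
        (A, B, S \<union> C) \<in> L \<longrightarrow> (A, C, S \<union> B) \<in> L \<longrightarrow> (A, B \<union> C, S) \<in> L)"

lemma intersection_forD:
  assumes "intersection_for V L A B C" "disjoint_quad V A B C S"
    and "(A, B, S \<union> C) \<in> L" "(A, C, S \<union> B) \<in> L"
  shows "(A, B \<union> C, S) \<in> L"
  using assms unfolding intersection_for_def by simp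

lemma intersection_for_commute:
  assumes "intersection_for V L A B C"
  shows "intersection_for V L A C B"
  using assms unfolding intersection_for_def disjoint_quad_def
  by (simp add: Int_commute[of B C] Un_commute[of B C])

text \<open>
  Contraction reduces the conclusion to \<open>(A,B|S)\<close>. Starting from \<open>(A,B|SC\<^sub>1C\<^sub>2)\<close>, the rule for
  \<open>C\<^sub>1\<close> over \<open>SC\<^sub>2\<close> removes \<open>C\<^sub>1\<close> from the condition, and then the rule for \<open>C\<^sub>2\<close> over \<open>S\<close> removes
  \<open>C\<^sub>2\<close>; weak union and decomposition of \<open>(A,C\<^sub>1C\<^sub>2|SB)\<close> supply the second premise in the two uses.
\<close>

lemma intersection_for_Un_right:
  assumes sg: "semigraphoid V L"
    and I1: "intersection_for V L A B C1" and I2: "intersection_for V L A B C2"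
    and ne: "C1 \<noteq> {}" "C2 \<noteq> {}" and disj: "C1 \<inter> C2 = {}"
  shows "intersection_for V L A B (C1 \<union> C2)"
  unfolding intersection_for_def
proof (intro allI impI)
  fix S
  assume q: "disjoint_quad V A B (C1 \<union> C2) S"
    and AB: "(A, B, S \<union> (C1 \<union> C2)) \<in> L" and AC: "(A, C1 \<union> C2, S \<union> B) \<in> L"
  have "(A, C1, (S \<union> B) \<union> C2) \<in> L"
    using q ne disj by (intro semigraphoid_weak_union[OF sg _ AC]) (auto simp: disjoint_quad_def)
  then have AC1: "(A, C1, (S \<union> C2) \<union> B) \<in> L"
    by (simp add: Un_ac)
  have "(A, C2 \<union> C1, S \<union> B) \<in> L"
    using AC by (simp add: Un_ac)
  then have AC2: "(A, C2, S \<union> B) \<in> L"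
    using q ne disj
    by (intro semigraphoid_decomposition[OF sg, of A C2 C1]) (auto simp: disjoint_quad_def)
  have q1: "disjoint_quad V A B C1 (S \<union> C2)"
    using q ne disj by (auto simp: disjoint_quad_def)
  have "(A, B, (S \<union> C2) \<union> C1) \<in> L"
    using AB by (simp add: Un_ac)
  from semigraphoid_decomposition[OF sg q1 intersection_forD[OF I1 q1 this AC1]]
  have AB2: "(A, B, S \<union> C2) \<in> L" .
  have q2: "disjoint_quad V A B C2 S"
    using q ne disj by (auto simp: disjoint_quad_def)
  from semigraphoid_decomposition[OF sg q2 intersection_forD[OF I2 q2 AB2 AC2]]
  have "(A, B, S) \<in> L" .
  moreover have "(A, C1 \<union> C2, B \<union> S) \<in> L"
    using AC by (simp add: Un_ac)
  ultimately show "(A, B \<union> (C1 \<union> C2), S) \<in> L"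
    by (rule semigraphoid_contraction[OF sg q])
qed

text \<open>
  By symmetry, decomposition and weak union also act on the first component. They give the
  premises for \<open>A\<^sub>1\<close> over \<open>S\<close> and for \<open>A\<^sub>2\<close> over \<open>SA\<^sub>1\<close>, and contraction on the first component
  puts the two conclusions \<open>(A\<^sub>1,BC|S)\<close> and \<open>(A\<^sub>2,BC|SA\<^sub>1)\<close> together.
\<close>

lemma intersection_for_Un_left:
  assumes sg: "semigraphoid V L"
    and I1: "intersection_for V L A1 B C" and I2: "intersection_for V L A2 B C"
    and ne: "A1 \<noteq> {}" "A2 \<noteq> {}" and disj: "A1 \<inter> A2 = {}"
  shows "intersection_for V L (A1 \<union> A2) B C"
  unfolding intersection_for_def
proof (intro allI impI)
  fix S
  assume q: "disjoint_quad V (A1 \<union> A2) B C S"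
    and AB: "(A1 \<union> A2, B, S \<union> C) \<in> L" and AC: "(A1 \<union> A2, C, S \<union> B) \<in> L"
  have BA: "(B, A1 \<union> A2, S \<union> C) \<in> L" and CA: "(C, A1 \<union> A2, S \<union> B) \<in> L"
    by (rule semigraphoid_symmetry[OF sg], fact)+
  have qB: "disjoint_quad V B A1 A2 (S \<union> C)" "disjoint_quad V B A2 A1 (S \<union> C)"
    and qC: "disjoint_quad V C A1 A2 (S \<union> B)" "disjoint_quad V C A2 A1 (S \<union> B)"
    using q ne disj by (auto simp: disjoint_quad_def)
  have q1: "disjoint_quad V A1 B C S" and q2: "disjoint_quad V A2 B C (S \<union> A1)"
    and q12: "disjoint_quad V (B \<union> C) A1 A2 S"
    using q ne disj by (auto simp: disjoint_quad_def)
  have "(A1, B, S \<union> C) \<in> L" "(A1, C, S \<union> B) \<in> L"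
    by (rule semigraphoid_symmetry[OF sg], rule semigraphoid_decomposition[OF sg], fact, fact)+
  then have 1: "(A1, B \<union> C, S) \<in> L"
    by (rule intersection_forD[OF I1 q1])
  have BA': "(B, A2 \<union> A1, S \<union> C) \<in> L" and CA': "(C, A2 \<union> A1, S \<union> B) \<in> L"
    using BA CA by (simp_all only: Un_commute[of A2 A1])
  have "(A2, B, (S \<union> C) \<union> A1) \<in> L" "(A2, C, (S \<union> B) \<union> A1) \<in> L"
    by (rule semigraphoid_symmetry[OF sg], rule semigraphoid_weak_union[OF sg], fact, fact)+
  then have "(A2, B, (S \<union> A1) \<union> C) \<in> L" "(A2, C, (S \<union> A1) \<union> B) \<in> L"
    by (simp_all add: Un_ac)
  then have "(A2, B \<union> C, S \<union> A1) \<in> L"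
    by (rule intersection_forD[OF I2 q2])
  from semigraphoid_symmetry[OF sg this] have "(B \<union> C, A2, A1 \<union> S) \<in> L"
    by (simp add: Un_commute)
  with semigraphoid_symmetry[OF sg 1] have "(B \<union> C, A1 \<union> A2, S) \<in> L"
    by (rule semigraphoid_contraction[OF sg q12])
  then show "(A1 \<union> A2, B \<union> C, S) \<in> L"
    by (rule semigraphoid_symmetry[OF sg])
qed

text \<open>
  The pseudographoid rule only yields \<open>(a,b|S)\<close> and \<open>(a,c|S)\<close>. The joint statement \<open>(a,bc|S)\<close>
  follows by contracting the first of these with the premise \<open>(a,c|Sb)\<close>.
\<close>

lemma intersection_for_singletons:
  assumes sg: "semigraphoid V L" and pg: "pseudographoid_closed V L"
  shows "intersection_for V L {a} {b} {c}"
  unfolding intersection_for_def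
proof (intro allI impI)
  fix S
  assume q: "disjoint_quad V {a} {b} {c} S"
    and ab: "({a}, {b}, S \<union> {c}) \<in> L" and ac: "({a}, {c}, S \<union> {b}) \<in> L"
  have "a \<in> V" "b \<in> V" "c \<in> V" "a \<noteq> b" "a \<noteq> c" "b \<noteq> c" "S \<subseteq> V - {a, b, c}"
    using q by (auto simp: disjoint_quad_def)
  then have "({a}, {b}, S) \<in> L"
    using pg ab ac unfolding pseudographoid_closed_def by simp
  moreover have "({a}, {c}, {b} \<union> S) \<in> L"
    using ac by (simp add: Un_commute)
  ultimately show "({a}, {b} \<union> {c}, S) \<in> L"
    by (rule semigraphoid_contraction[OF sg q])
qed

lemma intersection_for_from_singletons_right:
  assumes sg: "semigraphoid V L" and "finite C" "C \<noteq> {}"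
    and single: "\<And>c. intersection_for V L A B {c}"
  shows "intersection_for V L A B C"
  using assms(2,3)
proof (induction rule: finite_ne_induct)
  case (singleton c)
  show ?case by (rule single)
next
  case (insert c F)
  then show ?case
    using intersection_for_Un_right[OF sg single, of F c] by simp
qed

lemma intersection_for_from_singletons_left:
  assumes sg: "semigraphoid V L" and "finite A" "A \<noteq> {}"
    and single: "\<And>a. intersection_for V L {a} B C"
  shows "intersection_for V L A B C"
  using assms(2,3)
proof (induction rule: finite_ne_induct)
  case (singleton a)
  show ?case by (rule single)
next
  case (insert a F)
  then show ?case
    using intersection_for_Un_left[OF sg single, of F a] by simp
qed

lemma intersection_closed_if_pseudographoid_closed:
  assumes "finite V" and sg: "semigraphoid V L" and pg: "pseudographoid_closed V L"
  shows "intersection_closed V L"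
proof -
  have "intersection_for V L A B C" if q: "disjoint_quad V A B C S" for A B C S
  proof -
    have fin: "finite A" "finite B" "finite C" and ne: "A \<noteq> {}" "B \<noteq> {}" "C \<noteq> {}"
      using q finite_subset[OF _ assms(1)] by (simp_all add: disjoint_quad_def)
    have "intersection_for V L {a} {b} C" for a b
      using sg fin(3) ne(3) intersection_for_singletons[OF sg pg]
      by (rule intersection_for_from_singletons_right)
    then have "intersection_for V L {a} C {b}" for a b
      by (rule intersection_for_commute)
    then have "intersection_for V L {a} C B" for a
      by (rule intersection_for_from_singletons_right[OF sg fin(2) ne(2)])
    then have "intersection_for V L {a} B C" for a
      by (rule intersection_for_commute)
    then show ?thesis
      by (rule intersection_for_from_singletons_left[OF sg fin(1) ne(1)])
  qed
  then show ?thesis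
    unfolding intersection_closed_def by (intro allI impI) (rule intersection_forD)
qed

lemma pseudographoid_closed_if_intersection_closed:
  assumes sg: "semigraphoid V L" and int: "intersection_closed V L"
  shows "pseudographoid_closed V L"
  unfolding pseudographoid_closed_def
proof (intro ballI allI impI)
  fix a b c S
  assume "a \<in> V" "b \<in> V" "c \<in> V" "a \<noteq> b" "a \<noteq> c" "b \<noteq> c" "S \<subseteq> V - {a, b, c}"
    and ab: "({a}, {b}, S \<union> {c}) \<in> L" and ac: "({a}, {c}, S \<union> {b}) \<in> L"
  then have q: "disjoint_quad V {a} {b} {c} S" and q': "disjoint_quad V {a} {c} {b} S"
    by (auto simp: disjoint_quad_def)
  have bc: "({a}, {b} \<union> {c}, S) \<in> L"
    using int[unfolded intersection_closed_def, rule_format, OF q ab ac] .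
  then have cb: "({a}, {c} \<union> {b}, S) \<in> L"
    by (simp only: Un_commute[of "{c}" "{b}"])
  show "({a}, {b}, S) \<in> L \<and> ({a}, {c}, S) \<in> L"
    using semigraphoid_decomposition[OF sg q bc] semigraphoid_decomposition[OF sg q' cb] ..
qed

theorem lemma5p2:
  fixes V :: "'v set" and L :: "('v set \<times> 'v set \<times> 'v set) set"
  assumes "finite V"
    and "L \<subseteq> triples V"
    and "semigraphoid V L"
  shows "pseudographoid_closed V L \<longleftrightarrow> intersection_closed V L"
  using intersection_closed_if_pseudographoid_closed[OF assms(1,3)]
    pseudographoid_closed_if_intersection_closed[OF assms(3)]
  by blast

end
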